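(* Let $m\ge1$, $S_1,\dots,S_k\subseteq\mathbb{Z}_m$, suppose $\Gamma=\mathrm{DiCay}(\mathbb{Z}_m,S_1,\dots,S_k)$ is reduced, and let $l$ be coprime to $m$. Then, as maps of $\mathrm{Aut}^{\mathrm{Ch}}(\Gamma)$, $\iota(\psi_l)\circ\gamma\circ\iota(\psi_l)^{-1}=\gamma^l$.
   Context: $\mathrm{DiCay}(\mathbb{Z}_m,S_1,\dots,S_k)$ is the colored digraph on $\mathbb{Z}_m$ with color-$i$ edges $\{(x,y)\mid y-x\in S_i\}$; it is reduced iff no nonzero $h\in\mathbb{Z}_m$ satisfies $S_i+h=S_i$ for all $i$. The chain $\mathrm{Ch}(\Gamma)$ is the colored digraph on $\mathbb{Z}_m\times\mathbb{Z}$ with a color-$j$ edge from $(v,i)$ to $(w,i+1)$ iff $w-v\in S_j$. $\mathrm{Aut}_{\mathrm{Ch}}(\Gamma)$ is the group of sequences $(\sigma_i)_{i\in\mathbb{Z}}$ of permutations of $\mathbb{Z}_m$ with $(v,i)\mapsto(\sigma_i(v),i)$ a color-preserving automorphism of $\mathrm{Ch}(\Gamma)$; $\mathrm{Aut}^{\mathrm{Ch}}(\Gamma)=\{\sigma_0\}$. For reduced $\Gamma$, a sequence in $\mathrm{Aut}_{\mathrm{Ch}}(\Gamma)$ is determined by $\sigma_0$, and $\gamma:\mathrm{Aut}^{\mathrm{Ch}}(\Gamma)\to\mathrm{Aut}^{\mathrm{Ch}}(\Gamma)$ is defined by $\gamma(\sigma_0)=\sigma_1$. Also $\psi_l(x)=lx$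 and $\iota(\psi_l)(\varphi)=\psi_l\circ\varphi\circ\psi_l^{-1}$, which maps $\mathrm{Aut}^{\mathrm{Ch}}(\Gamma)$ onto itself. *)

theory Defs
  imports "HOL-Algebra.Bij" "HOL-Combinatorics.Permutations"
begin

text \<open>The group of integers modulo \<open>m\<close> is represented by the residues \<open>0, \<dots>, m - 1\<close> with
  arithmetic modulo \<open>m\<close>.\<close>

definition Zmod :: "nat \<Rightarrow> int set" where
  "Zmod m = {0..<int m}"

record 'a colored_digraph =
  vertices :: "'a set"
  colors :: "nat set"
  edges :: "nat \<Rightarrow> ('a \<times> 'a) set"

definition color_automorphism :: "'a colored_digraph \<Rightarrow> ('a \<Rightarrow> 'a) \<Rightarrow> bool" where
  "color_automorphism G f \<longleftrightarrow>
     bij_betw f (vertices G) (vertices G) \<and>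
     (\<forall>j\<in>colors G. \<forall>x\<in>vertices G. \<forall>y\<in>vertices G.
        (x, y) \<in> edges G j \<longleftrightarrow> (f x, f y) \<in> edges G j)"

definition DiCay :: "nat \<Rightarrow> nat \<Rightarrow> (nat \<Rightarrow> int set) \<Rightarrow> int colored_digraph" where
  "DiCay m k S =
     \<lparr>vertices = Zmod m,
      colors = {1..k},
      edges = (\<lambda>i. {(x, y). x \<in> Zmod m \<and> y \<in> Zmod m \<and> (y - x) mod int m \<in> S i})\<rparr>"

definition reduced :: "nat \<Rightarrow> nat \<Rightarrow> (nat \<Rightarrow> int set) \<Rightarrow> bool" where
  "reduced m k S \<longleftrightarrow>
     \<not> (\<exists>h\<in>Zmod m. h \<noteq> 0 \<and> (\<forall>i\<in>{1..k}. (\<lambda>s. (s + h) mod int m) ` S i = S i))"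

text \<open>For \<open>G = DiCay m k S\<close>, the condition \<open>(v, w) \<in> edges G j\<close> says that \<open>v\<close> and \<open>w\<close> are residues
  whose difference \<open>w - v\<close> modulo \<open>m\<close> lies in \<open>S j\<close>.\<close>

definition Ch :: "'a colored_digraph \<Rightarrow> ('a \<times> int) colored_digraph" where
  "Ch G =
     \<lparr>vertices = vertices G \<times> UNIV,
      colors = colors G,
      edges = (\<lambda>j. {((v, i), (w, i + 1)) | v w i. (v, w) \<in> edges G j})\<rparr>"

text \<open>A permutation of the vertex set is a function on the whole type that fixes everything
  outside that set (\<open>permutes\<close>), so that equal permutations are equal functions.\<close>

definition Aut_Ch_seq :: "'a colored_digraph \<Rightarrow> (int \<Rightarrow> 'a \<Rightarrow> 'a) set" where
  "Aut_Ch_seq G =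
     {\<sigma>. (\<forall>i. \<sigma> i permutes vertices G) \<and>
         color_automorphism (Ch G) (\<lambda>(v, i). (\<sigma> i v, i))}"

definition Aut_Ch :: "'a colored_digraph \<Rightarrow> ('a \<Rightarrow> 'a) set" where
  "Aut_Ch G = {\<sigma> 0 | \<sigma>. \<sigma> \<in> Aut_Ch_seq G}"

text \<open>The description below is meaningful when the sequence is determined by its term of index 0,
  as is the case for reduced \<open>DiCay m k S\<close>.\<close>

definition gamma :: "'a colored_digraph \<Rightarrow> ('a \<Rightarrow> 'a) \<Rightarrow> 'a \<Rightarrow> 'a" where
  "gamma G = (\<lambda>\<phi>\<in>Aut_Ch G. THE \<psi>. \<exists>\<sigma>\<in>Aut_Ch_seq G. \<sigma> 0 = \<phi> \<and> \<sigma> 1 = \<psi>)"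

definition psi :: "nat \<Rightarrow> int \<Rightarrow> int \<Rightarrow> int" where
  "psi m l x = (if x \<in> Zmod m then (l * x) mod int m else x)"

text \<open>\<open>inv_into UNIV f\<close> is the inverse function of \<open>f\<close>; the notation \<open>inv\<close> is taken by groups.\<close>

definition iota :: "'a colored_digraph \<Rightarrow> ('a \<Rightarrow> 'a) \<Rightarrow> ('a \<Rightarrow> 'a) \<Rightarrow> 'a \<Rightarrow> 'a" where
  "iota G f = (\<lambda>\<phi>\<in>Aut_Ch G. f \<circ> \<phi> \<circ> inv_into UNIV f)"

end

theory Submission imports
  Defs
  "HOL-Computational_Algebra.Polynomial"
  "HOL-Computational_Algebra.Primes"
  "HOL-Number_Theory.Cong"
begin

text \<open>Schur's multiplier argument. An automorphism \<open>\<sigma>\<close> of the chain preserves the number of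
  walks of length \<open>p\<close> in one color \<open>S\<close>. For a prime \<open>p\<close> not dividing \<open>m\<close>, the identity
  \<open>(\<Sum>s\<in>S. X ^ s) ^ p = (\<Sum>s\<in>S. X ^ (p s))\<close> modulo \<open>p\<close> shows that the number of walks from
  \<open>(v, i)\<close> to \<open>(w, i + p)\<close> is congruent to 1 or 0 modulo \<open>p\<close>, according to whether \<open>w - v\<close> lies in
  \<open>p S\<close>. So the differences in \<open>p S\<close> are preserved between \<open>\<sigma> i\<close> and \<open>\<sigma> (i + p)\<close>, and conjugating
  the subsequence \<open>\<sigma> (p i)\<close> by \<open>\<psi>\<^sub>p\<close> gives another automorphism of the chain. This property of \<open>p\<close> is
  multiplicative, and it holds for \<open>-1\<close> by reversal of the edges, hence for every \<open>l\<close> coprime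
  to \<open>m\<close>. Since \<open>\<gamma>\<close> is the index shift, the theorem is a restatement.\<close>

section \<open>Walk counts modulo a prime\<close>

text \<open>The action of polynomials on functions in which \<open>X\<close> is the translation by 1. With
  \<open>set_poly T = (\<Sum>s\<in>T. X ^ s)\<close>, the operator of \<open>set_poly T ^ n\<close> sums a function over the endpoints of
  the walks of length \<open>n\<close> from \<open>v\<close> with steps in \<open>T\<close>.\<close>

definition shift_act :: "int poly \<Rightarrow> (int \<Rightarrow> int) \<Rightarrow> int \<Rightarrow> int" where
  "shift_act P f v = (\<Sum>n\<le>degree P. coeff P n * f (v + int n))"

lemma shift_act_altdef:
  assumes "degree P \<le> N"
  shows "shift_act P f v = (\<Sum>n\<le>N. coeff P n * f (v + int n))"
  unfolding shift_act_def
  by (rule sum.mono_neutral_left) (use assms in \<open>auto simp: coeff_eq_0\<close>)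

lemma shift_act_0 [simp]: "shift_act 0 f v = 0"
  by (simp add: shift_act_def)

lemma shift_act_pCons: "shift_act (pCons a P) f v = a * f v + shift_act P f (v + 1)"
proof -
  have "shift_act (pCons a P) f v = (\<Sum>n\<le>Suc (degree P). coeff (pCons a P) n * f (v + int n))"
    by (rule shift_act_altdef) (rule degree_pCons_le)
  also have "\<dots> = a * f v + shift_act P f (v + 1)"
    by (subst sum.atMost_Suc_shift) (simp add: shift_act_def add_ac)
  finally show ?thesis .
qed

lemma shift_act_add: "shift_act (P + Q) f v = shift_act P f v + shift_act Q f v"
proof -
  let ?N = "max (degree P) (degree Q)"
  have "shift_act (P + Q) f v = (\<Sum>n\<le>?N. coeff (P + Q) n * f (v + int n))"
    by (rule shift_act_altdef) (rule degree_add_le_max)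
  then show ?thesis
    by (simp add: shift_act_altdef[of P ?N] shift_act_altdef[of Q ?N] algebra_simps sum.distrib)
qed

lemma shift_act_sum: "shift_act (\<Sum>s\<in>A. P s) f v = (\<Sum>s\<in>A. shift_act (P s) f v)"
  by (induction A rule: infinite_finite_induct) (auto simp: shift_act_add)

lemma shift_act_smult: "shift_act (smult c P) f v = c * shift_act P f v"
  by (simp add: shift_act_altdef[of "smult c P" "degree P"] shift_act_def sum_distrib_left mult_ac)

text \<open>This is the module law: products of polynomials act by composition, so powers of
  \<open>set_poly T\<close> iterate the one-step sum.\<close>

lemma shift_act_mult: "shift_act (P * Q) f v = shift_act P (shift_act Q f) v"
  by (induction P arbitrary: v) (simp_all add: shift_act_add shift_act_smult shift_act_pCons)

lemma shift_act_monom: "shift_act (monom 1 n) f v = f (v + int n)"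
  by (induction n arbitrary: v) (simp_all add: monom_0 monom_Suc shift_act_pCons add_ac)

section \<open>Additivity of the p-th power modulo p\<close>

text \<open>The inner binomial coefficients of a prime row are divisible by \<open>p\<close>. The
  form as a divisibility, rather than as an identity in characteristic \<open>p\<close>, suits
  \<open>int poly\<close>, where walk counts remain integers.\<close>

lemma add_power_prime:
  fixes x y :: "'a::comm_ring_1"
  assumes p: "prime p"
  shows "of_nat p dvd (x + y) ^ p - (x ^ p + y ^ p)"
proof -
  have p0: "p > 0" using p prime_gt_0_nat by blast
  have "(x + y) ^ p = (\<Sum>k\<le>p. of_nat (p choose k) * x ^ k * y ^ (p - k))"
    by (rule binomial_ring)
  also have "\<dots> = (\<Sum>k\<in>{0,p}. of_nat (p choose k) * x ^ k * y ^ (p - k)) +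
                   (\<Sum>k\<in>{..p} - {0,p}. of_nat (p choose k) * x ^ k * y ^ (p - k))"
    by (subst add.commute, rule sum.subset_diff) auto
  finally have "(x + y) ^ p - (x ^ p + y ^ p)
      = (\<Sum>k\<in>{..p} - {0,p}. of_nat (p choose k) * x ^ k * y ^ (p - k))"
    using p0 by simp
  also have "of_nat p dvd \<dots>"
  proof (rule dvd_sum)
    fix k assume "k \<in> {..p} - {0,p}"
    then have "p dvd (p choose k)" using p p0 by (intro dvd_choose_prime) auto
    then have "(of_nat p :: 'a) dvd of_nat (p choose k)" by (metis dvd_def of_nat_mult)
    then show "of_nat p dvd of_nat (p choose k) * x ^ k * y ^ (p - k)" by (simp add: dvd_mult2)
  qed
  finally show ?thesis .
qed

lemma sum_power_prime:
  fixes a :: "'b \<Rightarrow> 'a::comm_ring_1"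
  assumes p: "prime p"
  shows "of_nat p dvd (\<Sum>i\<in>A. a i) ^ p - (\<Sum>i\<in>A. a i ^ p)"
proof (induction A rule: infinite_finite_induct)
  case (insert i A)
  have "of_nat p dvd ((a i + sum a A) ^ p - (a i ^ p + sum a A ^ p)) + (sum a A ^ p - (\<Sum>i\<in>A. a i ^ p))"
    by (intro dvd_add add_power_prime p insert.IH)
  then show ?case using insert.hyps by (simp add: algebra_simps)
qed (use p prime_gt_0_nat in \<open>auto simp: power_0_left\<close>)

section \<open>Walks under a sequence of permutations\<close>

text \<open>One step of the chain in one color: \<alpha> moves the tails and \<beta> the heads of
  the edges, later as \<sigma> i and \<sigma> (i + 1).\<close>

definition compatible :: "nat \<Rightarrow> int set \<Rightarrow> (int \<Rightarrow> int) \<Rightarrow> (int \<Rightarrow> int) \<Rightarrow> bool" where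
  "compatible m T \<alpha> \<beta> \<longleftrightarrow>
     (\<forall>v\<in>Zmod m. \<forall>w\<in>Zmod m. (w - v) mod int m \<in> T \<longleftrightarrow> (\<beta> w - \<alpha> v) mod int m \<in> T)"

lemma mod_in_Zmod [simp]: "m \<ge> 1 \<Longrightarrow> x mod int m \<in> Zmod m"
  by (simp add: Zmod_def)

lemma Zmod_mod_eq: "x \<in> Zmod m \<Longrightarrow> x mod int m = x"
  by (simp add: Zmod_def)

lemma finite_Zmod [simp]: "finite (Zmod m)"
  by (simp add: Zmod_def)

lemma sum_translate:
  assumes m: "m \<ge> 1" and T: "T \<subseteq> Zmod m"
  shows "(\<Sum>s\<in>T. g ((v + s) mod int m)) = (\<Sum>w\<in>{w\<in>Zmod m. (w - v) mod int m \<in> T}. g w)"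
proof (rule sum.reindex_bij_witness[of _ "\<lambda>w. (w - v) mod int m" "\<lambda>s. (v + s) mod int m"])
  fix s assume "s \<in> T"
  then have "s mod int m = s" using T Zmod_mod_eq by blast
  then show *: "((v + s) mod int m - v) mod int m = s" by (simp add: mod_simps)
  show "(v + s) mod int m \<in> {w \<in> Zmod m. (w - v) mod int m \<in> T}" using * \<open>s \<in> T\<close> m by simp
next
  fix w assume "w \<in> {w \<in> Zmod m. (w - v) mod int m \<in> T}"
  then show "(v + (w - v) mod int m) mod int m = w" by (simp add: mod_simps Zmod_mod_eq)
qed auto

lemma sum_compatible:
  assumes m: "m \<ge> 1" and T: "T \<subseteq> Zmod m"
    and \<alpha>: "\<alpha> permutes Zmod m" and \<beta>: "\<beta> permutes Zmod m" and c: "compatible m T \<alpha> \<beta>"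
  shows "(\<Sum>s\<in>T. f (\<beta> ((v + s) mod int m))) = (\<Sum>s\<in>T. f ((\<alpha> (v mod int m) + s) mod int m))"
proof -
  let ?u = "v mod int m"
  have "(\<Sum>s\<in>T. f (\<beta> ((v + s) mod int m))) = (\<Sum>s\<in>T. f (\<beta> ((?u + s) mod int m)))"
    by (simp add: mod_simps)
  also have "\<dots> = (\<Sum>w\<in>{w\<in>Zmod m. (w - ?u) mod int m \<in> T}. f (\<beta> w))"
    by (rule sum_translate[OF m T])
  also have "\<dots> = (\<Sum>w\<in>{w\<in>Zmod m. (w - \<alpha> ?u) mod int m \<in> T}. f w)"
  proof (rule sum.reindex_bij_witness[of _ "inv_into UNIV \<beta>" \<beta>])
    fix w assume w: "w \<in> {w \<in> Zmod m. (w - ?u) mod int m \<in> T}"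
    show "inv_into UNIV \<beta> (\<beta> w) = w" using \<beta> by (simp add: permutes_inverses)
    show "\<beta> w \<in> {w \<in> Zmod m. (w - \<alpha> ?u) mod int m \<in> T}"
      using w c m permutes_in_image[OF \<beta>] unfolding compatible_def by auto
  next
    fix w assume w: "w \<in> {w \<in> Zmod m. (w - \<alpha> ?u) mod int m \<in> T}"
    show *: "\<beta> (inv_into UNIV \<beta> w) = w" using \<beta> by (simp add: permutes_inverses)
    have "inv_into UNIV \<beta> w \<in> Zmod m"
      using w permutes_in_image[OF \<beta>, of "inv_into UNIV \<beta> w"] by (simp add: *)
    moreover from this have "(inv_into UNIV \<beta> w - ?u) mod int m \<in> T"
      using w c m unfolding compatible_def by (metis (mono_tags, lifting) "*" mem_Collect_eq mod_in_Zmod)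
    ultimately show "inv_into UNIV \<beta> w \<in> {w \<in> Zmod m. (w - ?u) mod int m \<in> T}" by simp
  qed auto
  also have "\<dots> = (\<Sum>s\<in>T. f ((\<alpha> ?u + s) mod int m))"
    by (rule sum_translate[OF m T, symmetric])
  finally show ?thesis .
qed

definition set_poly :: "int set \<Rightarrow> int poly" where
  "set_poly T = (\<Sum>s\<in>T. monom 1 (nat s))"

lemma shift_act_set_poly:
  assumes "T \<subseteq> Zmod m"
  shows "shift_act (set_poly T) f v = (\<Sum>s\<in>T. f (v + s))"
  unfolding set_poly_def shift_act_sum shift_act_monom
  by (rule sum.cong) (use assms in \<open>auto simp: Zmod_def\<close>)

text \<open>The walk sums intertwine \<sigma> i and \<sigma> (i + n), because each single step does
  by \<open>sum_compatible\<close>. The induction needs arbitrary \<open>f\<close>, as peeling off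
  the last step changes the function summed.\<close>

lemma shift_act_power_compatible:
  assumes m: "m \<ge> 1" and T: "T \<subseteq> Zmod m"
    and \<sigma>: "\<And>i. \<sigma> i permutes Zmod m" and c: "\<And>i. compatible m T (\<sigma> i) (\<sigma> (i + 1))"
  shows "shift_act (set_poly T ^ n) (\<lambda>x. f (\<sigma> (i + int n) (x mod int m))) v =
         shift_act (set_poly T ^ n) (\<lambda>x. f (x mod int m)) (\<sigma> i (v mod int m))"
proof (induction n arbitrary: f)
  case 0
  have "\<sigma> i (v mod int m) mod int m = \<sigma> i (v mod int m)"
    using permutes_in_image[OF \<sigma>] m by (intro Zmod_mod_eq) simp
  then show ?case by (simp add: shift_act_def)
next
  case (Suc n)
  let ?P = "set_poly T"
  \<comment> \<open>\<open>g\<close> sums \<open>f\<close> over the last step; it moves the function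
    from level \<open>i + n + 1\<close> to level \<open>i + n\<close>, where the induction
    hypothesis applies.\<close>
  define g where "g y = (\<Sum>s\<in>T. f ((y + s) mod int m))" for y
  have 1: "shift_act ?P (\<lambda>x. f (\<sigma> (i + int (Suc n)) (x mod int m))) = (\<lambda>x. g (\<sigma> (i + int n) (x mod int m)))"
    unfolding shift_act_set_poly[OF T] g_def
    using sum_compatible[OF m T \<sigma> \<sigma> c, of f "i + int n"]
    by (intro ext) (simp add: add_ac)
  have 2: "shift_act ?P (\<lambda>x. f (x mod int m)) = (\<lambda>x. g (x mod int m))"
    by (intro ext) (simp add: shift_act_set_poly[OF T] g_def mod_simps)
  show ?case
    by (simp only: power_Suc2 shift_act_mult 1 2 Suc.IH)
qed

text \<open>The congruence between polynomials is written as an equation with a multiple of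
  \<open>p\<close>, and both sides act on \<open>f\<close>. The p-th power of a monomial
  \<open>X ^ s\<close> acts as the translation by \<open>p s\<close>.\<close>

lemma shift_act_prime_power:
  assumes T: "T \<subseteq> Zmod m" and p: "prime p"
  shows "int p dvd shift_act (set_poly T ^ p) f v - (\<Sum>s\<in>T. f (v + int p * s))"
proof -
  have "of_nat p dvd set_poly T ^ p - (\<Sum>s\<in>T. monom 1 (nat s) ^ p)"
    unfolding set_poly_def by (rule sum_power_prime[OF p])
  then obtain Q where "set_poly T ^ p - (\<Sum>s\<in>T. monom 1 (nat s) ^ p) = of_nat p * Q" ..
  then have "set_poly T ^ p = (\<Sum>s\<in>T. monom 1 (nat s * p)) + smult (int p) Q"
    by (simp add: monom_power of_nat_poly algebra_simps)
  then have "shift_act (set_poly T ^ p) f v = (\<Sum>s\<in>T. f (v + int (nat s * p))) + int p * shift_act Q f v"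
    by (simp add: shift_act_add shift_act_sum shift_act_monom shift_act_smult)
  moreover have "(\<Sum>s\<in>T. f (v + int (nat s * p))) = (\<Sum>s\<in>T. f (v + int p * s))"
    by (rule sum.cong) (use T in \<open>auto simp: Zmod_def mult.commute\<close>)
  ultimately show ?thesis by simp
qed

lemma mult_mod_cancel:
  assumes "coprime l (int m)"
  shows "(l * a) mod int m = (l * b) mod int m \<longleftrightarrow> a mod int m = b mod int m"
  using assms cong_mult_lcancel[of l "int m" a b] by (simp add: cong_def)

text \<open>Multiplication by \<open>l\<close> is injective on residues, so at most one summand is
  nonzero.\<close>

lemma sum_indicator_progression:
  assumes T: "T \<subseteq> Zmod m" and l: "coprime l (int m)"
  shows "(\<Sum>s\<in>T. of_bool ((v + l * s) mod int m = w)) = (of_bool (\<exists>s\<in>T. (v + l * s) mod int m = w) :: int)"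
proof (cases "\<exists>s\<in>T. (v + l * s) mod int m = w")
  case True
  then obtain s where s: "s \<in> T" "(v + l * s) mod int m = w" by blast
  have uniq: "(v + l * t) mod int m = w \<longleftrightarrow> t = s" if "t \<in> T" for t
  proof
    assume "(v + l * t) mod int m = w"
    then have "(v + l * t - v) mod int m = (v + l * s - v) mod int m"
      using s by (intro mod_diff_cong) auto
    then have "t mod int m = s mod int m" using mult_mod_cancel[OF l] by simp
    then show "t = s" using that s T by (metis Zmod_mod_eq subsetD)
  qed (use s in simp)
  have "(\<Sum>t\<in>T. of_bool ((v + l * t) mod int m = w)) = (\<Sum>t\<in>T. if t = s then 1 else (0::int))"
    by (rule sum.cong) (auto simp: uniq)
  also have "\<dots> = 1" using s finite_subset[OF T] by simp
  finally show ?thesis using True by simp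
qed (auto intro!: sum.neutral)

text \<open>There are as many walks of length \<open>p\<close> from \<open>v\<close> to
  \<open>w\<close> as between their images. Both indicators are congruent to this number modulo
  \<open>p\<close>, hence to each other.\<close>

lemma progression_prime:
  assumes m: "m \<ge> 1" and T: "T \<subseteq> Zmod m"
    and \<sigma>: "\<And>i. \<sigma> i permutes Zmod m" and c: "\<And>i. compatible m T (\<sigma> i) (\<sigma> (i + 1))"
    and p: "prime p" "coprime (int p) (int m)" and v: "v \<in> Zmod m" and w: "w \<in> Zmod m"
  shows "(\<exists>s\<in>T. (v + int p * s) mod int m = w) \<longleftrightarrow>
         (\<exists>s\<in>T. (\<sigma> i v + int p * s) mod int m = \<sigma> (i + int p) w)"
proof -
  \<comment> \<open>With the indicator of the image of \<open>w\<close>, the sums count the walks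
    that end there.\<close>
  let ?f = "\<lambda>y. of_bool (y = \<sigma> (i + int p) w) :: int"
  let ?b = "of_bool (\<exists>s\<in>T. (v + int p * s) mod int m = w) :: int"
  let ?c = "of_bool (\<exists>s\<in>T. (\<sigma> i v + int p * s) mod int m = \<sigma> (i + int p) w) :: int"
  have inj: "\<sigma> (i + int p) x = \<sigma> (i + int p) w \<longleftrightarrow> x = w" for x
    using permutes_inj[OF \<sigma>] by (auto dest: injD)
  have b: "(\<Sum>s\<in>T. ?f (\<sigma> (i + int p) ((v + int p * s) mod int m))) = ?b"
    unfolding inj by (rule sum_indicator_progression[OF T p(2)])
  have c': "(\<Sum>s\<in>T. ?f ((\<sigma> i v + int p * s) mod int m)) = ?c"
    by (rule sum_indicator_progression[OF T p(2)])
  let ?X = "shift_act (set_poly T ^ p) (\<lambda>x. ?f (x mod int m)) (\<sigma> i v)"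
  have X: "shift_act (set_poly T ^ p) (\<lambda>x. ?f (\<sigma> (i + int p) (x mod int m))) v = ?X"
    using shift_act_power_compatible[of m T \<sigma> p ?f i v, OF m T \<sigma> c] Zmod_mod_eq[OF v] by simp
  have "int p dvd ?X - ?b"
    unfolding X[symmetric] b[symmetric] by (rule shift_act_prime_power[OF T p(1)])
  moreover have "int p dvd ?X - ?c"
    unfolding c'[symmetric] by (rule shift_act_prime_power[OF T p(1)])
  ultimately have "int p dvd (?X - ?b) - (?X - ?c)" by (rule dvd_diff)
  then have "int p dvd ?c - ?b" by simp
  \<comment> \<open>Two numbers from 0 and 1 that are congruent modulo \<open>p \<ge> 2\<close> are
    equal.\<close>
  moreover have "p \<ge> 2" using p(1) prime_ge_2_nat by blast
  ultimately show ?thesis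
    by (cases "\<exists>s\<in>T. (v + int p * s) mod int m = w";
        cases "\<exists>s\<in>T. (\<sigma> i v + int p * s) mod int m = \<sigma> (i + int p) w") auto
qed

section \<open>Multipliers\<close>

lemma psi_permutes:
  assumes m: "m \<ge> 1" and l: "coprime l (int m)"
  shows "psi m l permutes Zmod m"
proof (rule bij_imp_permutes)
  have "inj_on (psi m l) (Zmod m)"
    by (rule inj_onI) (metis psi_def mult_mod_cancel[OF l] Zmod_mod_eq)
  moreover have "psi m l ` Zmod m \<subseteq> Zmod m" using m by (auto simp: psi_def)
  ultimately show "bij_betw (psi m l) (Zmod m) (Zmod m)"
    by (simp add: bij_betw_def endo_inj_surj)
qed (simp add: psi_def)

lemma psi_mult: "m \<ge> 1 \<Longrightarrow> psi m (a * b) = psi m a \<circ> psi m b"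
  by (auto simp: psi_def fun_eq_iff mod_simps mult.assoc)

lemma psi_cong: "a mod int m = b mod int m \<Longrightarrow> psi m a = psi m b"
  unfolding psi_def by (auto simp: fun_eq_iff) (metis mod_mult_left_eq)

lemma psi_diff:
  assumes "m \<ge> 1" "a \<in> Zmod m" "b \<in> Zmod m"
  shows "(psi m l a - psi m l b) mod int m = (l * (a - b)) mod int m"
  using assms by (simp add: psi_def mod_simps right_diff_distrib)

text \<open>If \<open>\<sigma>\<close> is an automorphism of the chain, then so is \<open>mult_seq m l \<sigma>\<close>
  (\<open>mult_seq_in_Aut_Ch_seq\<close>): conjugation by \<open>\<psi>\<^sub>l\<close> divides the index by \<open>l\<close>.\<close>

definition mult_seq :: "nat \<Rightarrow> int \<Rightarrow> (int \<Rightarrow> int \<Rightarrow> int) \<Rightarrow> int \<Rightarrow> int \<Rightarrow> int" where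
  "mult_seq m l \<sigma> i = inv_into UNIV (psi m l) \<circ> \<sigma> (l * i) \<circ> psi m l"

text \<open>This lets the multiplier property pass from prime factors and the sign to all
  \<open>l\<close> coprime to \<open>m\<close>.\<close>

lemma mult_seq_mult:
  assumes m: "m \<ge> 1" and a: "coprime a (int m)" and b: "coprime b (int m)"
  shows "mult_seq m (a * b) \<sigma> = mult_seq m b (mult_seq m a \<sigma>)"
proof -
  have "inv_into UNIV (psi m (a * b)) = inv_into UNIV (psi m b) \<circ> inv_into UNIV (psi m a)"
    unfolding psi_mult[OF m] using psi_permutes[OF m] a b by (intro o_inv_distrib permutes_bij)
  then show ?thesis
    by (intro ext) (simp add: mult_seq_def psi_mult[OF m] mult_ac)
qed

lemma psi_1 [simp]: "psi m 1 = id"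
  by (auto simp: psi_def fun_eq_iff Zmod_mod_eq)

lemma mult_seq_1 [simp]: "mult_seq m 1 \<sigma> = \<sigma>"
  by (intro ext) (simp add: mult_seq_def)

lemma mult_seq_permutes:
  assumes m: "m \<ge> 1" and l: "coprime l (int m)" and \<sigma>: "\<And>i. \<sigma> i permutes Zmod m"
  shows "mult_seq m l \<sigma> i permutes Zmod m"
  unfolding mult_seq_def by (intro permutes_compose permutes_inv psi_permutes m l \<sigma>)

lemma psi_mult_seq:
  assumes m: "m \<ge> 1" and l: "coprime l (int m)"
  shows "psi m l (mult_seq m l \<sigma> i x) = \<sigma> (l * i) (psi m l x)"
  unfolding mult_seq_def using permutes_inverses(1)[OF psi_permutes[OF m l]] by simp

text \<open>As \<open>l\<close> is a unit modulo \<open>m\<close>, a difference lies in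
  \<open>T\<close> exactly when its multiple by \<open>l\<close> lies in \<open>l T\<close>. The
  right side has the shape treated by \<open>progression_prime\<close>.\<close>

lemma mod_mem_iff_mult:
  assumes m: "m \<ge> 1" and T: "T \<subseteq> Zmod m" and l: "coprime l (int m)"
    and a: "a \<in> Zmod m" and b: "b \<in> Zmod m"
  shows "(b - a) mod int m \<in> T \<longleftrightarrow> (\<exists>s\<in>T. (psi m l a + l * s) mod int m = psi m l b)"
proof -
  have "(psi m l a + l * s) mod int m = psi m l b \<longleftrightarrow> s = (b - a) mod int m" if "s \<in> T" for s
  proof -
    have "(psi m l a + l * s) mod int m = (l * (a + s)) mod int m"
      using a by (simp add: psi_def mod_simps distrib_left)
    then have "(psi m l a + l * s) mod int m = psi m l b \<longleftrightarrow> (a + s) mod int m = b mod int m"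
      using b by (simp add: psi_def mult_mod_cancel[OF l])
    also have "\<dots> \<longleftrightarrow> s mod int m = (b - a) mod int m"
      by (simp add: mod_eq_dvd_iff algebra_simps)
    finally show ?thesis using Zmod_mod_eq[of s m] that T by auto
  qed
  then show ?thesis by blast
qed

text \<open>Applying \<open>psi m (int p)\<close> turns \<open>T\<close> into \<open>p T\<close>,
  while one step of the new index is \<open>p\<close> steps of the old one. This is the situation of
  \<open>progression_prime\<close>.\<close>

lemma compatible_mult_seq_prime:
  assumes m: "m \<ge> 1" and T: "T \<subseteq> Zmod m"
    and \<sigma>: "\<And>i. \<sigma> i permutes Zmod m" and c: "\<And>i. compatible m T (\<sigma> i) (\<sigma> (i + 1))"
    and p: "prime p" "coprime (int p) (int m)"
  shows "compatible m T (mult_seq m (int p) \<sigma> i) (mult_seq m (int p) \<sigma> (i + 1))"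
  unfolding compatible_def
proof (intro ballI)
  fix v w assume v: "v \<in> Zmod m" and w: "w \<in> Zmod m"
  let ?\<tau> = "mult_seq m (int p) \<sigma>" and ?\<psi> = "psi m (int p)"
  note in_img = permutes_in_image[OF psi_permutes[OF m p(2)]]
    permutes_in_image[OF mult_seq_permutes[OF m p(2), of \<sigma>, OF \<sigma>]]
  have "(w - v) mod int m \<in> T \<longleftrightarrow> (\<exists>s\<in>T. (?\<psi> v + int p * s) mod int m = ?\<psi> w)"
    by (rule mod_mem_iff_mult[OF m T p(2) v w])
  also have "\<dots> \<longleftrightarrow> (\<exists>s\<in>T. (\<sigma> (int p * i) (?\<psi> v) + int p * s) mod int m = \<sigma> (int p * i + int p) (?\<psi> w))"
    by (rule progression_prime[of m T \<sigma>, OF m T \<sigma> c p]) (simp_all add: in_img v w)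
  also have "\<dots> \<longleftrightarrow> (\<exists>s\<in>T. (?\<psi> (?\<tau> i v) + int p * s) mod int m = ?\<psi> (?\<tau> (i + 1) w))"
    by (simp add: psi_mult_seq[OF m p(2)] distrib_left)
  also have "\<dots> \<longleftrightarrow> (?\<tau> (i + 1) w - ?\<tau> i v) mod int m \<in> T"
    by (rule mod_mem_iff_mult[OF m T p(2), symmetric]) (simp_all add: in_img v w)
  finally show "(w - v) mod int m \<in> T \<longleftrightarrow> (?\<tau> (i + 1) w - ?\<tau> i v) mod int m \<in> T" .
qed

text \<open>Negation exchanges head and tail of an edge, and the index \<open>- i\<close> runs
  through the levels backwards; the two reversals cancel.\<close>

lemma compatible_mult_seq_minus:
  assumes m: "m \<ge> 1"
    and \<sigma>: "\<And>i. \<sigma> i permutes Zmod m" and c: "\<And>i. compatible m T (\<sigma> i) (\<sigma> (i + 1))"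
  shows "compatible m T (mult_seq m (- 1) \<sigma> i) (mult_seq m (- 1) \<sigma> (i + 1))"
  unfolding compatible_def
proof (intro ballI)
  fix v w assume v: "v \<in> Zmod m" and w: "w \<in> Zmod m"
  let ?\<tau> = "mult_seq m (- 1) \<sigma>" and ?\<psi> = "psi m (- 1)"
  have cop: "coprime (- 1) (int m)" by simp
  note in_img = permutes_in_image[OF psi_permutes[OF m cop]]
    permutes_in_image[OF mult_seq_permutes[OF m cop, of \<sigma>, OF \<sigma>]]
  have "(w - v) mod int m \<in> T \<longleftrightarrow> (?\<psi> v - ?\<psi> w) mod int m \<in> T"
    by (simp add: psi_diff[OF m v w])
  also have "\<dots> \<longleftrightarrow> (\<sigma> (- i - 1 + 1) (?\<psi> v) - \<sigma> (- i - 1) (?\<psi> w)) mod int m \<in> T"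
    \<comment> \<open>The level \<open>- (i + 1)\<close> of the image of \<open>w\<close> now comes
      just before the level \<open>- i\<close> of the image of \<open>v\<close>.\<close>
    using c[of "- i - 1"] v w in_img unfolding compatible_def by blast
  also have "\<dots> \<longleftrightarrow> (?\<psi> (?\<tau> i v) - ?\<psi> (?\<tau> (i + 1) w)) mod int m \<in> T"
    by (simp add: psi_mult_seq[OF m cop])
  also have "\<dots> \<longleftrightarrow> (?\<tau> (i + 1) w - ?\<tau> i v) mod int m \<in> T"
    by (subst psi_diff[OF m]) (simp_all add: in_img v w)
  finally show "(w - v) mod int m \<in> T \<longleftrightarrow> (?\<tau> (i + 1) w - ?\<tau> i v) mod int m \<in> T" .
qed

section \<open>Automorphisms of the chain and their multipliers\<close>

text \<open>Edges join only consecutive levels, so preservation splits into one condition per level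
  and color; bijectivity on the chain follows from that on each level.\<close>

lemma Aut_Ch_seq_DiCay_iff:
  "\<sigma> \<in> Aut_Ch_seq (DiCay m k S) \<longleftrightarrow>
     (\<forall>i. \<sigma> i permutes Zmod m) \<and> (\<forall>j\<in>{1..k}. \<forall>i. compatible m (S j) (\<sigma> i) (\<sigma> (i + 1)))"
proof (cases "\<forall>i. \<sigma> i permutes Zmod m")
  case True
  then have perm: "\<And>i. \<sigma> i permutes Zmod m" by blast
  let ?f = "\<lambda>(v, i). (\<sigma> i v, i)"
  have bij: "bij_betw ?f (Zmod m \<times> UNIV) (Zmod m \<times> UNIV)"
    by (rule bij_betw_byWitness[where f' = "\<lambda>(v, i). (inv_into UNIV (\<sigma> i) v, i)"])
       (auto simp: permutes_inverses[OF perm] permutes_in_image[OF perm]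
         permutes_in_image[OF permutes_inv[OF perm]])
  have edge: "((v, i), (w, i')) \<in> edges (Ch (DiCay m k S)) j \<longleftrightarrow>
      i' = i + 1 \<and> v \<in> Zmod m \<and> w \<in> Zmod m \<and> (w - v) mod int m \<in> S j" for v w i i' j
    by (auto simp: Ch_def DiCay_def)
  have V: "vertices (Ch (DiCay m k S)) = Zmod m \<times> UNIV" "colors (Ch (DiCay m k S)) = {1..k}"
    "vertices (DiCay m k S) = Zmod m"
    by (simp_all add: Ch_def DiCay_def)
  have "color_automorphism (Ch (DiCay m k S)) ?f \<longleftrightarrow>
      (\<forall>j\<in>{1..k}. \<forall>v\<in>Zmod m. \<forall>i. \<forall>w\<in>Zmod m. \<forall>i'.
         (i' = i + 1 \<and> (w - v) mod int m \<in> S j) \<longleftrightarrow> (i' = i + 1 \<and> (\<sigma> i' w - \<sigma> i v) mod int m \<in> S j))"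
    unfolding color_automorphism_def V using bij
    by (simp add: edge permutes_in_image[OF perm])
  also have "\<dots> \<longleftrightarrow> (\<forall>j\<in>{1..k}. \<forall>i. compatible m (S j) (\<sigma> i) (\<sigma> (i + 1)))"
    unfolding compatible_def by blast
  finally have "color_automorphism (Ch (DiCay m k S)) ?f \<longleftrightarrow>
      (\<forall>j\<in>{1..k}. \<forall>i. compatible m (S j) (\<sigma> i) (\<sigma> (i + 1)))" .
  then show ?thesis using True by (simp add: Aut_Ch_seq_def V)
next
  case False
  then have "\<not> (\<forall>i. \<sigma> i permutes vertices (DiCay m k S))" by (simp add: DiCay_def)
  with False show ?thesis unfolding Aut_Ch_seq_def by blast
qed

lemma Aut_Ch_seq_shift:
  assumes "\<sigma> \<in> Aut_Ch_seq (DiCay m k S)"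
  shows "(\<lambda>i. \<sigma> (i + c)) \<in> Aut_Ch_seq (DiCay m k S)"
  using assms unfolding Aut_Ch_seq_DiCay_iff by (metis add.assoc add.commute)

lemma mult_seq_in_Aut_Ch_seq:
  assumes m: "m \<ge> 1" and S: "\<forall>j\<in>{1..k}. S j \<subseteq> Zmod m" and l: "coprime l (int m)"
    and \<sigma>: "\<sigma> \<in> Aut_Ch_seq (DiCay m k S)"
  shows "mult_seq m l \<sigma> \<in> Aut_Ch_seq (DiCay m k S)"
proof -
  have prime: "mult_seq m (int p) \<sigma> \<in> Aut_Ch_seq (DiCay m k S)"
    if "prime p" "coprime (int p) (int m)" "\<sigma> \<in> Aut_Ch_seq (DiCay m k S)" for p \<sigma>
    unfolding Aut_Ch_seq_DiCay_iff
  proof (intro conjI allI ballI)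
    have \<sigma>: "\<And>i. \<sigma> i permutes Zmod m" using that(3) by (simp add: Aut_Ch_seq_DiCay_iff)
    show "mult_seq m (int p) \<sigma> i permutes Zmod m" for i
      by (rule mult_seq_permutes[OF m that(2) \<sigma>])
    fix i j assume j: "j \<in> {1..k}"
    have c: "\<And>i. compatible m (S j) (\<sigma> i) (\<sigma> (i + 1))"
      using that(3) j by (simp add: Aut_Ch_seq_DiCay_iff)
    have "S j \<subseteq> Zmod m" using S j by blast
    then show "compatible m (S j) (mult_seq m (int p) \<sigma> i) (mult_seq m (int p) \<sigma> (i + 1))"
      by (rule compatible_mult_seq_prime[of m "S j" \<sigma>, OF m _ \<sigma> c that(1,2)])
  qed
  have minus: "mult_seq m (- 1) \<sigma> \<in> Aut_Ch_seq (DiCay m k S)"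
    if "\<sigma> \<in> Aut_Ch_seq (DiCay m k S)" for \<sigma>
    unfolding Aut_Ch_seq_DiCay_iff
  proof (intro conjI allI ballI)
    have \<sigma>: "\<And>i. \<sigma> i permutes Zmod m" using that by (simp add: Aut_Ch_seq_DiCay_iff)
    show "mult_seq m (- 1) \<sigma> i permutes Zmod m" for i
      by (rule mult_seq_permutes[OF m _ \<sigma>]) simp
    fix i j assume "j \<in> {1..k}"
    then have c: "\<And>i. compatible m (S j) (\<sigma> i) (\<sigma> (i + 1))"
      using that by (simp add: Aut_Ch_seq_DiCay_iff)
    show "compatible m (S j) (mult_seq m (- 1) \<sigma> i) (mult_seq m (- 1) \<sigma> (i + 1))"
      by (rule compatible_mult_seq_minus[of m \<sigma>, OF m \<sigma> c])
  qed
  have nat: "mult_seq m (int n) \<sigma> \<in> Aut_Ch_seq (DiCay m k S)"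
    if "coprime (int n) (int m)" "\<sigma> \<in> Aut_Ch_seq (DiCay m k S)" for n \<sigma>
    using that
  proof (induction n arbitrary: \<sigma> rule: prime_divisors_induct)
    case zero \<comment> \<open>\<open>0\<close> is coprime to \<open>m\<close> only for \<open>m = 1\<close>\<close>
    then have "Zmod m = {0}" by (auto simp: Zmod_def)
    then have id: "\<tau> = id" if "\<tau> permutes Zmod m" for \<tau>
      using that by (simp add: permutes_sing)
    have \<sigma>: "\<And>i. \<sigma> i permutes Zmod m" using zero(2) by (simp add: Aut_Ch_seq_DiCay_iff)
    have "mult_seq m (int 0) \<sigma> = \<sigma>"
    proof
      fix i
      show "mult_seq m (int 0) \<sigma> i = \<sigma> i"
        by (rule trans[OF id[OF mult_seq_permutes[OF m zero(1) \<sigma>]] id[OF \<sigma>, symmetric]])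
    qed
    then show ?case using zero by simp
  next
    case (unit n)
    then show ?case by simp
  next
    case (factor p n)
    then have "coprime (int p) (int m)" "coprime (int n) (int m)" by simp_all
    \<comment> \<open>The induction hypothesis is applied to the sequence already transformed by
      \<open>p\<close>, hence the generalization over \<sigma>.\<close>
    then show ?case using factor.IH prime[OF \<open>prime p\<close>] factor.prems(2) by (simp add: mult_seq_mult[OF m])
  qed
  show ?thesis
  proof (cases "l \<ge> 0")
    case True
    then show ?thesis using nat[of "nat l" \<sigma>] l \<sigma> by simp
  next
    case False
    then have eq: "l = - 1 * int (nat (- l))" and c: "coprime (int (nat (- l))) (int m)" using l by auto
    have "mult_seq m l \<sigma> = mult_seq m (int (nat (- l))) (mult_seq m (- 1) \<sigma>)"
      by (subst eq, rule mult_seq_mult[OF m _ c]) simp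
    then show ?thesis using nat[OF c minus[OF \<sigma>]] by (simp only:)
  qed
qed

lemma iota_inverse:
  assumes "bij f" "\<phi> \<in> Aut_Ch G" "iota G f \<phi> \<in> Aut_Ch G"
  shows "iota G (inv_into UNIV f) (iota G f \<phi>) = \<phi>"
proof -
  have "inv_into UNIV f \<circ> (f \<circ> \<phi> \<circ> inv_into UNIV f) \<circ> f = \<phi>"
    using assms(1) by (simp add: fun_eq_iff bij_is_inj)
  then show ?thesis using assms by (simp add: iota_def inv_inv_eq)
qed

section \<open>The index shift of a reduced digraph\<close>

locale reduced_DiCay =
  fixes m k :: nat and S :: "nat \<Rightarrow> int set"
  assumes m: "m \<ge> 1"
    and S: "\<forall>j\<in>{1..k}. S j \<subseteq> Zmod m"
    and red: "reduced m k S"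
begin

abbreviation "\<Gamma> \<equiv> DiCay m k S"

lemma seq_permutes: "\<sigma> \<in> Aut_Ch_seq \<Gamma> \<Longrightarrow> \<sigma> i permutes Zmod m"
  by (simp add: Aut_Ch_seq_DiCay_iff)

section \<open>Reducedness makes sequences unique\<close>

text \<open>If two vertices have the same out-neighbours in every color, translation by
  \<open>b - a\<close> fixes every \<open>S j\<close>, so reducedness forces it to be 0.\<close>

lemma eq_if_same_differences:
  assumes a: "a \<in> Zmod m" and b: "b \<in> Zmod m"
    and ab: "\<And>j x. j \<in> {1..k} \<Longrightarrow> (x - a) mod int m \<in> S j \<longleftrightarrow> (x - b) mod int m \<in> S j"
  shows "a = b"
proof (rule ccontr)
  assume "a \<noteq> b"
  let ?h = "(b - a) mod int m"
  have "?h \<noteq> 0"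
    using \<open>a \<noteq> b\<close> Zmod_mod_eq[OF a] Zmod_mod_eq[OF b] by (metis mod_0_imp_dvd mod_eq_dvd_iff)
  moreover have "(\<lambda>s. (s + ?h) mod int m) ` S j = S j" if j: "j \<in> {1..k}" for j
  proof
    have Sj: "s mod int m = s" if "s \<in> S j" for s using that S j Zmod_mod_eq by blast
    show "(\<lambda>s. (s + ?h) mod int m) ` S j \<subseteq> S j"
    proof clarify
      fix s assume "s \<in> S j"
      then have "(s + b - a) mod int m \<in> S j" using ab[OF j, of "s + b"] Sj by simp
      then show "(s + ?h) mod int m \<in> S j" by (simp add: mod_simps algebra_simps)
    qed
    show "S j \<subseteq> (\<lambda>s. (s + ?h) mod int m) ` S j"
    proof
      fix s assume s: "s \<in> S j"
      then have "(s + a - b) mod int m \<in> S j" using ab[OF j, of "s + a"] Sj by simp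
      moreover have "s = ((s + a - b) mod int m + ?h) mod int m" using Sj[OF s] by (simp add: mod_simps)
      ultimately show "s \<in> (\<lambda>s. (s + ?h) mod int m) ` S j" by blast
    qed
  qed
  ultimately show False using red m unfolding reduced_def by (meson mod_in_Zmod)
qed

lemma eq_if_same_differences':
  assumes a: "a \<in> Zmod m" and b: "b \<in> Zmod m"
    and ab: "\<And>j x. j \<in> {1..k} \<Longrightarrow> (a - x) mod int m \<in> S j \<longleftrightarrow> (b - x) mod int m \<in> S j"
  shows "a = b"
proof (rule eq_if_same_differences[OF a b])
  fix j x assume "j \<in> {1..k}"
  \<comment> \<open>The reflection of \<open>x\<close> in \<open>a + b\<close> turns in-neighbours
    into out-neighbours and swaps \<open>a\<close> and \<open>b\<close>.\<close>
  from ab[OF this, of "a + b - x"]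
  show "(x - a) mod int m \<in> S j \<longleftrightarrow> (x - b) mod int m \<in> S j" by (auto simp: algebra_simps)
qed

text \<open>The map on level \<open>i\<close> fixes the in-neighbours of every image on level
  \<open>i + 1\<close>, and the map on level \<open>i + 1\<close> fixes the out-neighbours of every
  image on level \<open>i\<close>. A vertex is determined by either.\<close>

lemma seq_step:
  assumes \<sigma>: "\<sigma> \<in> Aut_Ch_seq \<Gamma>" and \<tau>: "\<tau> \<in> Aut_Ch_seq \<Gamma>"
  shows "\<sigma> i = \<tau> i \<longleftrightarrow> \<sigma> (i + 1) = \<tau> (i + 1)"
proof -
  note perm = seq_permutes[OF \<sigma>] seq_permutes[OF \<tau>]
  have c: "(w - v) mod int m \<in> S j \<longleftrightarrow> (\<rho> (i + 1) w - \<rho> i v) mod int m \<in> S j"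
    if "\<rho> \<in> Aut_Ch_seq \<Gamma>" "j \<in> {1..k}" "v \<in> Zmod m" "w \<in> Zmod m" for \<rho> j v w
    using that unfolding Aut_Ch_seq_DiCay_iff compatible_def by blast
  show ?thesis
  proof
    assume eq: "\<sigma> i = \<tau> i"
    show "\<sigma> (i + 1) = \<tau> (i + 1)"
    proof
      fix w
      show "\<sigma> (i + 1) w = \<tau> (i + 1) w"
      proof (cases "w \<in> Zmod m")
        case True
        show ?thesis
        proof (rule eq_if_same_differences')
          fix j x assume j: "j \<in> {1..k}"
          obtain v where v: "v \<in> Zmod m" "\<sigma> i v = x mod int m"
            using permutes_image[OF perm(1)] mod_in_Zmod[OF m] by (metis imageE)
          show "(\<sigma> (i + 1) w - x) mod int m \<in> S j \<longleftrightarrow> (\<tau> (i + 1) w - x) mod int m \<in> S j"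
            using c[OF \<sigma> j v(1) True] c[OF \<tau> j v(1) True] eq v by (simp add: mod_simps)
        qed (use True perm in \<open>simp_all add: permutes_in_image\<close>)
      qed (simp add: perm[THEN permutes_not_in])
    qed
  next
    assume eq: "\<sigma> (i + 1) = \<tau> (i + 1)"
    show "\<sigma> i = \<tau> i"
    proof
      fix v
      show "\<sigma> i v = \<tau> i v"
      proof (cases "v \<in> Zmod m")
        case True
        show ?thesis
        proof (rule eq_if_same_differences)
          fix j x assume j: "j \<in> {1..k}"
          obtain w where w: "w \<in> Zmod m" "\<sigma> (i + 1) w = x mod int m"
            using permutes_image[OF perm(1)] mod_in_Zmod[OF m] by (metis imageE)
          show "(x - \<sigma> i v) mod int m \<in> S j \<longleftrightarrow> (x - \<tau> i v) mod int m \<in> S j"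
            using c[OF \<sigma> j True w(1)] c[OF \<tau> j True w(1)] eq w by (simp add: mod_simps)
        qed (use True perm in \<open>simp_all add: permutes_in_image\<close>)
      qed (simp add: perm[THEN permutes_not_in])
    qed
  qed
qed

text \<open>Agreement spreads from the index \<open>c\<close> in both directions. Index 0 makes
  \<open>gamma\<close> well defined, index 1 makes it injective.\<close>

lemma seq_unique:
  assumes "\<sigma> \<in> Aut_Ch_seq \<Gamma>" "\<tau> \<in> Aut_Ch_seq \<Gamma>" "\<sigma> c = \<tau> c"
  shows "\<sigma> = \<tau>"
proof
  fix i
  show "\<sigma> i = \<tau> i"
  proof (induction i rule: int_induct[where k = c])
    case base
    show ?case by (rule assms(3))
  next
    case (step1 i)
    then show ?case using seq_step[OF assms(1,2), of i] by simp
  next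
    case (step2 i)
    then show ?case using seq_step[OF assms(1,2), of "i - 1"] by simp
  qed
qed

lemma seq_in_Aut_Ch:
  assumes "\<sigma> \<in> Aut_Ch_seq \<Gamma>"
  shows "\<sigma> i \<in> Aut_Ch \<Gamma>"
  unfolding Aut_Ch_def mem_Collect_eq
  by (rule exI[of _ "\<lambda>n. \<sigma> (n + i)"]) (simp add: Aut_Ch_seq_shift assms)

section \<open>The maps gamma and iota as bijections\<close>

text \<open>The only sequence with \<sigma> i at index 0 is the shift of \<sigma> by
  \<open>i\<close>. Having all \<open>i\<close> at once allows iteration.\<close>

lemma gamma_seq:
  assumes \<sigma>: "\<sigma> \<in> Aut_Ch_seq \<Gamma>"
  shows "gamma \<Gamma> (\<sigma> i) = \<sigma> (i + 1)"
proof -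
  have "(THE \<psi>. \<exists>\<tau>\<in>Aut_Ch_seq \<Gamma>. \<tau> 0 = \<sigma> i \<and> \<tau> 1 = \<psi>) = \<sigma> (i + 1)"
  proof (rule the_equality)
    show "\<exists>\<tau>\<in>Aut_Ch_seq \<Gamma>. \<tau> 0 = \<sigma> i \<and> \<tau> 1 = \<sigma> (i + 1)"
      using Aut_Ch_seq_shift[OF \<sigma>, of i] by (intro bexI[of _ "\<lambda>n. \<sigma> (n + i)"]) (auto simp: add.commute)
  next
    fix \<psi> assume "\<exists>\<tau>\<in>Aut_Ch_seq \<Gamma>. \<tau> 0 = \<sigma> i \<and> \<tau> 1 = \<psi>"
    then obtain \<tau> where \<tau>: "\<tau> \<in> Aut_Ch_seq \<Gamma>" "\<tau> 0 = \<sigma> i" "\<tau> 1 = \<psi>" by blast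
    have "\<tau> = (\<lambda>n. \<sigma> (n + i))"
      by (rule seq_unique[OF \<tau>(1) Aut_Ch_seq_shift[OF \<sigma>], of 0]) (simp add: \<tau>)
    then show "\<psi> = \<sigma> (i + 1)" using \<tau>(3) by (simp add: add.commute)
  qed
  then show ?thesis using seq_in_Aut_Ch[OF \<sigma>] by (simp add: gamma_def)
qed

lemma Aut_Ch_cases:
  assumes "\<phi> \<in> Aut_Ch \<Gamma>"
  obtains \<sigma> where "\<sigma> \<in> Aut_Ch_seq \<Gamma>" "\<phi> = \<sigma> 0"
  using assms unfolding Aut_Ch_def by blast

text \<open>Membership in the group of bijections gives meaning to the powers of
  \<open>gamma\<close> with negative exponent.\<close>

lemma gamma_Bij: "gamma \<Gamma> \<in> Bij (Aut_Ch \<Gamma>)"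
proof -
  have "inj_on (gamma \<Gamma>) (Aut_Ch \<Gamma>)"
  proof (rule inj_onI)
    fix \<phi> \<chi> assume "\<phi> \<in> Aut_Ch \<Gamma>" "\<chi> \<in> Aut_Ch \<Gamma>" "gamma \<Gamma> \<phi> = gamma \<Gamma> \<chi>"
    then obtain \<sigma> \<tau> where st: "\<sigma> \<in> Aut_Ch_seq \<Gamma>" "\<phi> = \<sigma> 0" "\<tau> \<in> Aut_Ch_seq \<Gamma>" "\<chi> = \<tau> 0"
      by (metis Aut_Ch_cases)
    then have "\<sigma> 1 = \<tau> 1" using gamma_seq[of \<sigma> 0] gamma_seq[of \<tau> 0] \<open>gamma \<Gamma> \<phi> = gamma \<Gamma> \<chi>\<close> by simp
    then show "\<phi> = \<chi>" using seq_unique st by metis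
  qed
  moreover have "gamma \<Gamma> ` Aut_Ch \<Gamma> = Aut_Ch \<Gamma>"
  proof
    show "gamma \<Gamma> ` Aut_Ch \<Gamma> \<subseteq> Aut_Ch \<Gamma>"
      by (auto elim!: Aut_Ch_cases simp: gamma_seq seq_in_Aut_Ch)
    show "Aut_Ch \<Gamma> \<subseteq> gamma \<Gamma> ` Aut_Ch \<Gamma>"
    proof
      fix \<phi> assume "\<phi> \<in> Aut_Ch \<Gamma>"
      then obtain \<sigma> where s: "\<sigma> \<in> Aut_Ch_seq \<Gamma>" "\<phi> = \<sigma> 0" by (rule Aut_Ch_cases)
      then show "\<phi> \<in> gamma \<Gamma> ` Aut_Ch \<Gamma>"
        \<comment> \<open>The preimage of \<sigma> 0 is \<sigma> (- 1).\<close>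
        using gamma_seq[OF s(1), of "- 1"] seq_in_Aut_Ch[OF s(1), of "- 1"] by force
    qed
  qed
  ultimately show ?thesis
    unfolding Bij_def bij_betw_def by (simp add: gamma_def)
qed

lemma mult_seq_Aut: "coprime l (int m) \<Longrightarrow> \<sigma> \<in> Aut_Ch_seq \<Gamma> \<Longrightarrow> mult_seq m l \<sigma> \<in> Aut_Ch_seq \<Gamma>"
  by (rule mult_seq_in_Aut_Ch_seq[OF m S])

lemma psi_inverse:
  assumes l: "coprime l (int m)"
  obtains l' where "coprime l' (int m)" "psi m l' = inv_into UNIV (psi m l)"
    "inv_into UNIV (psi m l') = psi m l"
proof -
  obtain l' where l': "[l * l' = 1] (mod int m)" using l cong_solve_coprime_int by blast
  then have "coprime l' (int m)" using l by (metis cong_imp_coprime cong_sym coprime_1_left coprime_mult_left_iff)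
  have eq: "psi m l \<circ> psi m l' = id" "psi m l' \<circ> psi m l = id"
    using psi_cong[of "l * l'" m 1] l' unfolding cong_def by (simp_all add: psi_mult[OF m, symmetric] mult.commute)
  have "psi m l' = inv_into UNIV (psi m l)" "psi m l = inv_into UNIV (psi m l')"
    using inv_unique_comp[OF eq] inv_unique_comp[OF eq(2,1)] by simp_all
  with that \<open>coprime l' (int m)\<close> show ?thesis by metis
qed

text \<open>\<open>mult_seq\<close> has the inverse of \<open>psi\<close> on the left,
  \<open>iota\<close> has it on the right. So \<open>iota\<close> for \<open>l\<close> is the term
  of index 0 of \<open>mult_seq\<close> for an inverse \<open>l'\<close> of \<open>l\<close> modulo
  \<open>m\<close>.\<close>

lemma iota_Aut_Ch:
  assumes l: "coprime l (int m)" and \<phi>: "\<phi> \<in> Aut_Ch \<Gamma>"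
  shows "iota \<Gamma> (psi m l) \<phi> \<in> Aut_Ch \<Gamma>"
proof -
  obtain l' where l': "coprime l' (int m)" "psi m l' = inv_into UNIV (psi m l)"
    "inv_into UNIV (psi m l') = psi m l" using psi_inverse[OF l] .
  obtain \<sigma> where s: "\<sigma> \<in> Aut_Ch_seq \<Gamma>" "\<phi> = \<sigma> 0" using \<phi> by (rule Aut_Ch_cases)
  have "mult_seq m l' \<sigma> 0 = iota \<Gamma> (psi m l) \<phi>"
    using \<phi> s by (simp add: mult_seq_def iota_def l'(2)[symmetric] l'(3))
  then show ?thesis using seq_in_Aut_Ch[OF mult_seq_Aut[OF l'(1) s(1)]] by metis
qed

lemma iota_Bij:
  assumes l: "coprime l (int m)"
  shows "iota \<Gamma> (psi m l) \<in> Bij (Aut_Ch \<Gamma>)"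
proof -
  obtain l' where l': "coprime l' (int m)" "psi m l' = inv_into UNIV (psi m l)"
    "inv_into UNIV (psi m l') = psi m l" using psi_inverse[OF l] .
  have "bij_betw (iota \<Gamma> (psi m l)) (Aut_Ch \<Gamma>) (Aut_Ch \<Gamma>)"
  proof (rule bij_betw_byWitness[where f' = "iota \<Gamma> (psi m l')"])
    show "\<forall>\<phi>\<in>Aut_Ch \<Gamma>. iota \<Gamma> (psi m l') (iota \<Gamma> (psi m l) \<phi>) = \<phi>"
      using iota_inverse[OF permutes_bij[OF psi_permutes[OF m l]]] iota_Aut_Ch[OF l]
      unfolding l'(2) by blast
    show "\<forall>\<phi>\<in>Aut_Ch \<Gamma>. iota \<Gamma> (psi m l) (iota \<Gamma> (psi m l') \<phi>) = \<phi>"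
      using iota_inverse[OF permutes_bij[OF psi_permutes[OF m l'(1)]]] iota_Aut_Ch[OF l'(1)]
      unfolding l'(3) by blast
  qed (use iota_Aut_Ch[OF l] iota_Aut_Ch[OF l'(1)] in auto)
  then show ?thesis by (simp add: Bij_def iota_def)
qed

section \<open>Computation in the group of bijections\<close>

abbreviation "B \<equiv> BijGroup (Aut_Ch \<Gamma>)"

lemma B_mult:
  assumes "g \<in> carrier B" "f \<in> carrier B" "x \<in> Aut_Ch \<Gamma>"
  shows "(g \<otimes>\<^bsub>B\<^esub> f) x = g (f x)"
  using assms by (simp add: BijGroup_def compose_eq)

lemma gamma_pow_seq:
  assumes \<sigma>: "\<sigma> \<in> Aut_Ch_seq \<Gamma>"
  shows "(gamma \<Gamma> [^]\<^bsub>B\<^esub> (n :: int)) (\<sigma> i) = \<sigma> (i + n)"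
proof -
  interpret group B by (rule group_BijGroup)
  have g: "gamma \<Gamma> \<in> carrier B" using gamma_Bij by (simp add: BijGroup_def)
  have step: "(gamma \<Gamma> [^]\<^bsub>B\<^esub> (n + 1)) (\<sigma> i) = (gamma \<Gamma> [^]\<^bsub>B\<^esub> n) (\<sigma> (i + 1))" for n :: int and i
    using g seq_in_Aut_Ch[OF \<sigma>] by (simp add: int_pow_mult B_mult gamma_seq[OF \<sigma>])
  show ?thesis
  proof (induction n arbitrary: i rule: int_induct[where k = 0])
    case base
    show ?case using seq_in_Aut_Ch[OF \<sigma>] by (simp add: BijGroup_def)
  next
    case (step1 n)
    show ?case unfolding step step1.IH by (simp add: add_ac)
  next
    case (step2 n)
    \<comment> \<open>Both parameters drop by 1: the hypothesis for \<open>n\<close> at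
      \<open>i - 1\<close> gives the claim for \<open>n - 1\<close> at \<open>i\<close>.\<close>
    then show ?case using step[of "n - 1" "i - 1"] by (simp add: diff_add_eq add_diff_eq)
  qed
qed

text \<open>The conjugation identity without the inverse. If \<tau> is the sequence through the
  conjugate of \<sigma> 0, then \<sigma> is \<open>mult_seq m l \<tau>\<close> by uniqueness, and
  its term of index 1 shows that the conjugate of \<sigma> 1 is \<tau> l.\<close>

lemma iota_gamma:
  assumes l: "coprime l (int m)"
  shows "iota \<Gamma> (psi m l) \<otimes>\<^bsub>B\<^esub> gamma \<Gamma> = gamma \<Gamma> [^]\<^bsub>B\<^esub> l \<otimes>\<^bsub>B\<^esub> iota \<Gamma> (psi m l)"
    (is "?L = ?R")
proof -
  interpret group B by (rule group_BijGroup)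
  have g: "gamma \<Gamma> \<in> carrier B" and i: "iota \<Gamma> (psi m l) \<in> carrier B"
    using gamma_Bij iota_Bij[OF l] by (simp_all add: BijGroup_def)
  show ?thesis
  proof (rule extensionalityI)
    have "?L \<in> carrier B" "?R \<in> carrier B" using g i by simp_all
    then show "?L \<in> extensional (Aut_Ch \<Gamma>)" "?R \<in> extensional (Aut_Ch \<Gamma>)"
      by (simp_all add: BijGroup_def Bij_imp_extensional)
  next
    fix \<phi> assume \<phi>: "\<phi> \<in> Aut_Ch \<Gamma>"
    then obtain \<sigma> where s: "\<sigma> \<in> Aut_Ch_seq \<Gamma>" "\<phi> = \<sigma> 0" by (rule Aut_Ch_cases)
    obtain \<tau> where t: "\<tau> \<in> Aut_Ch_seq \<Gamma>" "iota \<Gamma> (psi m l) \<phi> = \<tau> 0"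
      using iota_Aut_Ch[OF l \<phi>] by (rule Aut_Ch_cases)
    note inv = permutes_inverses[OF psi_permutes[OF m l]]
    have "mult_seq m l \<tau> 0 = \<sigma> 0"
      using \<phi> by (simp add: mult_seq_def t(2)[symmetric] iota_def s fun_eq_iff inv)
    then have "mult_seq m l \<tau> = \<sigma>" using seq_unique mult_seq_Aut[OF l t(1)] s(1) by blast
    then have "\<sigma> 1 = mult_seq m l \<tau> 1" by simp
    then have "iota \<Gamma> (psi m l) (\<sigma> 1) = \<tau> l"
      using seq_in_Aut_Ch[OF s(1), of 1] by (simp add: iota_def fun_eq_iff mult_seq_def inv)
    then show "?L \<phi> = ?R \<phi>"
      using \<phi> s t g i gamma_seq[OF s(1), of 0] gamma_pow_seq[OF t(1), of l 0] by (simp add: B_mult)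
  qed
qed

end

theorem theorem3p14:
  fixes m k :: nat and S :: "nat \<Rightarrow> int set" and l :: int
  defines "\<Gamma> \<equiv> DiCay m k S"
  defines "B \<equiv> BijGroup (Aut_Ch \<Gamma>)"
  assumes "m \<ge> 1"
    and "\<forall>i\<in>{1..k}. S i \<subseteq> Zmod m"
    and "reduced m k S"
    and "coprime l (int m)"
  shows "iota \<Gamma> (psi m l) \<otimes>\<^bsub>B\<^esub> gamma \<Gamma> \<otimes>\<^bsub>B\<^esub> inv\<^bsub>B\<^esub> (iota \<Gamma> (psi m l)) = gamma \<Gamma> [^]\<^bsub>B\<^esub> l"
proof -
  interpret R: reduced_DiCay m k S by unfold_locales (use assms in auto)
  interpret group B unfolding B_def by (rule group_BijGroup)
  have "gamma \<Gamma> \<in> carrier B" "iota \<Gamma> (psi m l) \<in> carrier B"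
    using R.gamma_Bij R.iota_Bij[OF \<open>coprime l (int m)\<close>] by (simp_all add: B_def \<Gamma>_def BijGroup_def)
  \<comment> \<open>Multiplication of \<open>R.iota_gamma\<close> by the inverse from the right
    isolates the power of \<open>gamma\<close>.\<close>
  then show ?thesis
    using R.iota_gamma[OF \<open>coprime l (int m)\<close>] unfolding B_def[symmetric] \<Gamma>_def[symmetric]
    by (simp add: m_assoc)
qed

end
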